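(* Let $m,n\ge1$, let $\mathfrak{g}=\mathfrak{g}_{\bar 0}\oplus\mathfrak{g}_{\bar 1}=\mathfrak{osp}(m|2n)$ and $G=\mathrm{O}_{m}(\mathbb{C})\times\mathrm{Sp}_{2n}(\mathbb{C})$. Let $e\in\mathfrak{g}_{\bar 0}$ be nilpotent with Jordan type $\lambda=(\lambda_{1},\dots,\lambda_{a},\lambda_{a+1},\lambda_{-(a+1)},\dots,\lambda_{b},\lambda_{-b})$, where $\lambda_1>\dots>\lambda_a$ are the parts with odd multiplicity and $\lambda_{a+1}=\lambda_{-(a+1)}\ge\dots\ge\lambda_b=\lambda_{-b}$. Let $S=\langle e^{l}:l\text{ is odd and }l\leq\max\{\lambda_{1},\lambda_{a+1}\}-1\rangle$. Then $\left(\mathfrak{z}(\mathfrak{g}^{e})\right)^{G^{e}}=S$.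
   Context: Everything is over $\mathbb C$. Let $V=V_{\bar 0}\oplus V_{\bar 1}$ be a superspace with $\dim V_{\bar 0}=m$, $\dim V_{\bar 1}=2n$ and $B$ a non-degenerate even supersymmetric bilinear form on $V$ (symmetric on $V_{\bar 0}$, skew-symmetric on $V_{\bar 1}$, $B(V_{\bar 0},V_{\bar 1})=0$). $\mathfrak{osp}(m|2n)=\mathfrak{osp}(V)$ has parity-$\bar i$ part $\{x\in\mathfrak{gl}(V)_{\bar i}: B(xv,w)=-(-1)^{\bar i\bar v}B(v,xw)\text{ for homogeneous }v,w\}$; $G$ is the group of even automorphisms of $V$ preserving $B$, acting on $\mathfrak g$ by conjugation. $\mathfrak g^e=\{x\in\mathfrak g:[e,x]=0\}$; $\mathfrak z(\mathfrak g^e)=\{x\in\mathfrak g^e:[x,y]=0\ \forall y\in\mathfrak g^e\}$; $G^e=\{g\in G:geg^{-1}=e\}$; $(\mathfrak z(\mathfrak g^e))^{G^e}=\{x\in\mathfrak z(\mathfrak g^e):gxg^{-1}=x\ \forall g\in G^e\}$. $\langle\cdots\rangle$ denotes linear span, and $l$ ranges over positive odd integers. The Jordan type of $e$ is $(p|q)$, with $p$, $q$ the partitions of $m$ and $2n$ giving the Jordan types of $e|_{V_{\bar 0}}$ and $e|_{V_{\bar 1}}$ (even parts of $p$ and odd parts of $q$ have even multiplicity). Its parts are rearranged as $\lambda$ above: $\lambda_1>\dots>\lambda_a$ contains one copy of each part whose multiplicity in $p$ or in $q$ is odd, and the remaining parts are grouped in equal pairs $\lambda_i=\lambda_{-i}$,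 both from $p$ or both from $q$. Absent $\lambda_1$ (if $a=0$) or $\lambda_{a+1}$ (if $a=b$) are regarded as $0$. So $\max\{\lambda_1,\lambda_{a+1}\}$ is the largest part. *)

theory Defs
  imports
    Complex_Main
    "HOL-Library.Function_Algebras"
    "HOL-Library.Multiset"
    "HOL-Library.Z2"
begin

(* The Koszul sign (-1)^(i j). *)
definition koszul :: "bit \<Rightarrow> bit \<Rightarrow> complex" where
  "koszul i j = (if i = 1 \<and> j = 1 then - 1 else 1)"

(* The whole type 'v carries the superspace; V i is its part of parity i. *)
locale superspace = vector_space scale
  for scale :: "complex \<Rightarrow> 'v::ab_group_add \<Rightarrow> 'v" (infixr \<open>*s\<close> 75) +
  fixes V :: "bit \<Rightarrow> 'v set"
  assumes subspace_part: "subspace (V i)"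
    and parts_disjoint: "V 0 \<inter> V 1 = {0}"
    and parts_sum: "{u + w | u w. u \<in> V 0 \<and> w \<in> V 1} = UNIV"
    and finite_dim_part: "\<exists>S. finite S \<and> span S = V i"
begin

definition homogeneous_end :: "bit \<Rightarrow> ('v \<Rightarrow> 'v) set" where
  "homogeneous_end i = {x. Vector_Spaces.linear scale scale x \<and> (\<forall>j. x ` V j \<subseteq> V (i + j))}"

(* V (i + 1) is the part complementary to V i. *)
definition proj :: "bit \<Rightarrow> 'v \<Rightarrow> 'v" where
  "proj i v = (THE u. u \<in> V i \<and> v - u \<in> V (i + 1))"

definition component :: "bit \<Rightarrow> ('v \<Rightarrow> 'v) \<Rightarrow> 'v \<Rightarrow> 'v" where
  "component i x v = (\<Sum>j\<in>{0, 1}. proj (i + j) (x (proj j v)))"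

(* The bilinear extension of [x,y] = x y - (-1)^(i j) y x, for x of parity i and y of parity j;
   see bracket_homogeneous below. *)
definition bracket :: "('v \<Rightarrow> 'v) \<Rightarrow> ('v \<Rightarrow> 'v) \<Rightarrow> 'v \<Rightarrow> 'v" where
  "bracket x y v = (\<Sum>i\<in>{0, 1}. \<Sum>j\<in>{0, 1}.
      component i x (component j y v) - koszul i j *s component j y (component i x v))"

(* p is the multiset of Jordan block sizes of the nilpotent operator e on the e-stable
   subspace W: the chains w, e w, ..., e^(k-1) w with e^k w = 0, one for each part k of p,
   together form a basis of W. *)
definition nilpotent_jordan_type :: "('v \<Rightarrow> 'v) \<Rightarrow> 'v set \<Rightarrow> nat multiset \<Rightarrow> bool" where
  "nilpotent_jordan_type e W p \<longleftrightarrow>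
     (\<exists>ks ws. let I = {(i, j). i < length ks \<and> j < ks ! i}; f = (\<lambda>(i, j). (e ^^ j) (ws ! i)) in
        mset ks = p \<and> (\<forall>k \<in> set ks. 0 < k) \<and> length ws = length ks \<and>
        (\<forall>i < length ks. (e ^^ (ks ! i)) (ws ! i) = 0) \<and>
        inj_on f I \<and> independent (f ` I) \<and> span (f ` I) = W)"

end

locale orthosymplectic_space = superspace scale V
  for scale :: "complex \<Rightarrow> 'v::ab_group_add \<Rightarrow> 'v" (infixr \<open>*s\<close> 75)
    and V :: "bit \<Rightarrow> 'v set" +
  fixes B :: "'v \<Rightarrow> 'v \<Rightarrow> complex"
  assumes linear_left: "Vector_Spaces.linear scale (*) (\<lambda>v. B v w)"
    and linear_right: "Vector_Spaces.linear scale (*) (\<lambda>w. B v w)"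
    and even_form: "v \<in> V 0 \<Longrightarrow> w \<in> V 1 \<Longrightarrow> B v w = 0"
    and supersymmetric: "v \<in> V i \<Longrightarrow> w \<in> V j \<Longrightarrow> B v w = koszul i j * B w v"
    and nondegenerate: "(\<And>w. B v w = 0) \<Longrightarrow> v = 0"
begin

definition osp_part :: "bit \<Rightarrow> ('v \<Rightarrow> 'v) set" where
  "osp_part i = {x \<in> homogeneous_end i.
     \<forall>j k. \<forall>v \<in> V j. \<forall>w \<in> V k. B (x v) w = - koszul i j * B v (x w)}"

definition osp :: "('v \<Rightarrow> 'v) set" where
  "osp = {x + y | x y. x \<in> osp_part 0 \<and> y \<in> osp_part 1}"

definition centralizer :: "('v \<Rightarrow> 'v) \<Rightarrow> ('v \<Rightarrow> 'v) set" where
  "centralizer e = {x \<in> osp. bracket e x = 0}"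

definition centre_centralizer :: "('v \<Rightarrow> 'v) \<Rightarrow> ('v \<Rightarrow> 'v) set" where
  "centre_centralizer e = {x \<in> centralizer e. \<forall>y \<in> centralizer e. bracket x y = 0}"

(* This is O(V 0) x Sp(V 1). *)
definition isometry_group :: "('v \<Rightarrow> 'v) set" where
  "isometry_group = {g. Vector_Spaces.linear scale scale g \<and> bij g \<and> (\<forall>i. g ` V i = V i) \<and>
     (\<forall>v w. B (g v) (g w) = B v w)}"

definition stabilizer :: "('v \<Rightarrow> 'v) \<Rightarrow> ('v \<Rightarrow> 'v) set" where
  "stabilizer e = {g \<in> isometry_group. g \<circ> e \<circ> inv g = e}"

definition invariant_centre :: "('v \<Rightarrow> 'v) \<Rightarrow> ('v \<Rightarrow> 'v) set" where
  "invariant_centre e = {x \<in> centre_centralizer e. \<forall>g \<in> stabilizer e. g \<circ> x \<circ> inv g = x}"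

end

(* The parts of the partitions p and q listed together as lam i, for
   i = 1, ..., a, a+1, -(a+1), ..., b, -b.  Here par i records whether lam i comes from p (0)
   or from q (1); the members i and -i of a pair come from the same partition. *)
definition arrangement ::
    "nat multiset \<Rightarrow> nat multiset \<Rightarrow> nat \<Rightarrow> nat \<Rightarrow> (int \<Rightarrow> nat) \<Rightarrow> bool" where
  "arrangement p q a b lam \<longleftrightarrow> a \<le> b \<and>
     (\<forall>i j. 1 \<le> i \<and> i < j \<and> j \<le> int a \<longrightarrow> lam j < lam i) \<and>
     (\<forall>i j. int a < i \<and> i \<le> j \<and> j \<le> int b \<longrightarrow> lam j \<le> lam i) \<and>
     (\<forall>i. int a < i \<and> i \<le> int b \<longrightarrow> lam (- i) = lam i) \<and>
     lam ` {1..int a} = {k. odd (count p k) \<or> odd (count q k)} \<and>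
     (\<exists>par :: int \<Rightarrow> bit. let I = {1..int b} \<union> uminus ` {int a + 1..int b} in
        (\<forall>i. int a < i \<and> i \<le> int b \<longrightarrow> par (- i) = par i) \<and>
        image_mset lam (mset_set {i \<in> I. par i = 0}) = p \<and>
        image_mset lam (mset_set {i \<in> I. par i = 1}) = q)"

(* max(lam 1, lam (a+1)), with an absent lam 1 or lam (a+1) read as 0. *)
definition largest_part :: "nat \<Rightarrow> nat \<Rightarrow> (int \<Rightarrow> nat) \<Rightarrow> nat" where
  "largest_part a b lam =
     max (if a = 0 then 0 else lam 1) (if a = b then 0 else lam (int a + 1))"

context superspace
begin

lemma part_add_Int: "V (i + 1) \<inter> V i = {0}"
  using parts_disjoint by (cases i) auto

lemma proj_eqI:
  assumes "u \<in> V i" and "v - u \<in> V (i + 1)"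
  shows "proj i v = u"
  unfolding proj_def
proof (rule the_equality)
  fix u' assume u': "u' \<in> V i \<and> v - u' \<in> V (i + 1)"
  have "u' - u \<in> V i" using u' assms subspace_diff subspace_part by blast
  moreover have "(v - u) - (v - u') \<in> V (i + 1)" using u' assms subspace_diff subspace_part by blast
  ultimately have "u' - u \<in> V (i + 1) \<inter> V i" by simp
  then have "u' - u = 0" unfolding part_add_Int by (rule singletonD)
  then show "u' = u" by simp
qed (use assms in simp)

lemma proj_same: "v \<in> V i \<Longrightarrow> proj i v = v"
  by (rule proj_eqI) (auto simp: subspace_0 subspace_part)

lemma proj_other: "v \<in> V (i + 1) \<Longrightarrow> proj i v = 0"
  by (rule proj_eqI) (auto simp: subspace_0 subspace_part)

lemma decompose:
  obtains u w where "u \<in> V 0" "w \<in> V 1" "v = u + w"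
  using parts_sum by blast

lemma proj_0: "u \<in> V 0 \<Longrightarrow> w \<in> V 1 \<Longrightarrow> proj 0 (u + w) = u"
  by (rule proj_eqI) auto

lemma proj_1: "u \<in> V 0 \<Longrightarrow> w \<in> V 1 \<Longrightarrow> proj 1 (u + w) = w"
  by (rule proj_eqI) auto

lemma component_homogeneous:
  assumes "x \<in> homogeneous_end i"
  shows "component i x = x" and "component (i + 1) x = 0"
proof -
  have lin: "Vector_Spaces.linear scale scale x" and img: "\<And>j v. v \<in> V j \<Longrightarrow> x v \<in> V (i + j)"
    using assms unfolding homogeneous_end_def by blast+
  have "component i x v = x v \<and> component (i + 1) x v = 0" for v
  proof -
    obtain u w where uw: "u \<in> V 0" "w \<in> V 1" "v = u + w" by (rule decompose)
    have "proj i (x u) = x u" "proj (i + 1) (x w) = x w"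
      using img[OF uw(1)] img[OF uw(2)] by (simp_all only: add_0_right proj_same)
    moreover have "proj (i + 1) (x u) = 0" "proj i (x w) = 0"
      using img[OF uw(1)] img[OF uw(2)]
      by (simp_all only: proj_other add_0_right add.assoc one_add_one bit_2_eq_0)
    ultimately show ?thesis
      using uw module_hom.add[OF lin[unfolded linear_iff_module_hom]]
      by (cases i) (simp_all add: component_def proj_0 proj_1)
  qed
  then show "component i x = x" and "component (i + 1) x = 0" by (auto simp: fun_eq_iff)
qed

lemma bracket_homogeneous:
  assumes "x \<in> homogeneous_end i" and "y \<in> homogeneous_end j"
  shows "bracket x y v = x (y v) - koszul i j *s y (x v)"
proof -
  have "x 0 = 0" "y 0 = 0"
    using assms
    by (auto simp only: homogeneous_end_def mem_Collect_eq linear_iff_module_hom dest: module_hom.zero)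
  then show ?thesis
    using component_homogeneous[OF assms(1)] component_homogeneous[OF assms(2)]
    by (cases i; cases j) (simp_all add: bracket_def)
qed

end

end

theory Submission
  imports Defs "HOL-Computational_Algebra.Formal_Power_Series"
begin

text \<open>
  The parity involution, which is \<open>1\<close> on \<open>V 0\<close> and \<open>-1\<close> on \<open>V 1\<close>, lies in \<open>G\<^sup>e\<close>. Hence an invariant
  element \<open>x\<close> of the centre of \<open>\<gg>\<^sup>e\<close> is even, and its super brackets with \<open>\<gg>\<^sup>e\<close> are ordinary commutators.
  The heart of the matter is that \<open>x\<close> is a polynomial in \<open>e\<close>. Skew-adjointness of \<open>x\<close> then leaves only
  odd powers, and the powers from the largest part on vanish. Conversely odd powers
  of \<open>e\<close> lie in \<open>osp_part 0\<close> and commute with all linear maps that commute with \<open>e\<close>.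

  Let \<open>N\<close> be the nilpotency index of \<open>e\<close>. For homogeneous vectors \<open>u\<close>, \<open>w\<close>
  the map \<open>\<theta>\<close> sending \<open>z\<close> to \<open>\<Sum>k<N. B u (e\<^bsup>N-1-k\<^esup> z) e\<^sup>k w\<close> commutes with \<open>e\<close>; it is the analogue of a rank
  one map for the module \<open>V\<close> over the truncated polynomial ring in \<open>e\<close> (\<open>rank_one\<close>). Subtracting its
  superadjoint, which is \<open>\<theta>\<close> with \<open>u\<close> and \<open>w\<close> exchanged up to sign, gives an
  element of \<open>\<gg>\<^sup>e\<close> (\<open>skew_rank_one_centralizer\<close>). If this element acts on \<open>c\<close> and \<open>x c\<close> as a nonzero
  multiple of \<open>\<theta>\<close> and \<open>B u (e\<^bsup>N-1\<^esup> c) \<noteq> 0\<close>, then it takes \<open>c\<close> to an invertible polynomial in \<open>e\<close> applied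
  to \<open>w\<close>, so that a formula \<open>x c = P(e) c\<close> carries over to \<open>x w = P(e) w\<close>
  (\<open>polynomial_action_transfer\<close>).

  Choose a parity \<open>i\<close> for which \<open>e\<^bsup>N-1\<^esup>\<close> does not vanish on \<open>V i\<close>. If \<open>B v (e\<^bsup>N-1\<^esup> v) \<noteq> 0\<close> for some \<open>v\<close> in \<open>V i\<close>, then
  the \<open>e\<close>-stable space generated by \<open>v\<close> is non-degenerate, and the reflection in it lies in \<open>G\<^sup>e\<close>; it
  forces \<open>x v = P(e) v\<close>, and transfer from \<open>v\<close> covers the orthogonal complement, including the
  other parity (\<open>polynomial_symmetric\<close>). Otherwise the form \<open>B u (e\<^bsup>N-1\<^esup> v)\<close> is alternating on \<open>V i\<close>, and
  \<open>\<theta>\<close> for \<open>u = w\<close> itself lies in \<open>\<gg>\<^sup>e\<close>. This gives \<open>x u = P(e) u\<close> for one \<open>u\<close>, and then transfer from \<open>u\<close>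
  reaches a spanning set of \<open>V i\<close> and all of the other part (\<open>polynomial_alternating\<close>).
\<close>

section \<open>Superspaces and parity\<close>

lemma koszul_simps [simp]: "koszul 0 j = 1" "koszul i 0 = 1" "koszul 1 1 = - 1"
  by (simp_all add: koszul_def)

context superspace
begin

lemma linearI:
  assumes "\<And>u v. f (u + v) = f u + f v" and "\<And>c v. f (c *s v) = c *s f v"
  shows "Vector_Spaces.linear scale scale f"
  using assms by (simp add: Vector_Spaces.linear_iff vector_space_axioms)

lemma homogeneous_end_linear:
  assumes "x \<in> homogeneous_end i"
  shows "x (u + v) = x u + x v" and "x (c *s v) = c *s x v" and "x 0 = 0"
    and "x (u - v) = x u - x v" and "x (sum f A) = (\<Sum>k\<in>A. x (f k))"
proof -
  interpret x: module_hom scale scale x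
    using assms by (simp add: homogeneous_end_def linear_iff_module_hom)
  show "x (u + v) = x u + x v" and "x (c *s v) = c *s x v" and "x 0 = 0"
    and "x (u - v) = x u - x v" and "x (sum f A) = (\<Sum>k\<in>A. x (f k))"
    by (simp_all add: x.add x.scale x.diff x.sum)
qed

lemma homogeneous_endI:
  assumes "\<And>u v. f (u + v) = f u + f v" and "\<And>c v. f (c *s v) = c *s f v"
    and "\<And>j v. v \<in> V j \<Longrightarrow> f v \<in> V (i + j)"
  shows "f \<in> homogeneous_end i"
  using linearI[of f] assms unfolding homogeneous_end_def by blast

lemma homogeneous_end_mem: "x \<in> homogeneous_end i \<Longrightarrow> v \<in> V j \<Longrightarrow> x v \<in> V (i + j)"
  unfolding homogeneous_end_def by blast

lemma even_power_homogeneous: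
  assumes "x \<in> homogeneous_end 0"
  shows "x ^^ k \<in> homogeneous_end 0"
proof (rule homogeneous_endI)
  show "(x ^^ k) (u + v) = (x ^^ k) u + (x ^^ k) v" "(x ^^ k) (c *s v) = c *s (x ^^ k) v" for u v c
    by (induction k) (simp_all add: homogeneous_end_linear[OF assms])
  show "(x ^^ k) v \<in> V (0 + j)" if "v \<in> V j" for v j
  proof (induction k)
    case (Suc k)
    then show ?case using homogeneous_end_mem[OF assms, of "(x ^^ k) v" j]
      by (simp only: funpow.simps comp_apply add_0)
  qed (use that in \<open>simp only: funpow.simps id_apply add_0\<close>)
qed

lemma decompose_parity:
  obtains u w where "u \<in> V i" "w \<in> V (i + 1)" "v = u + w"
proof -
  obtain u w where uw: "u \<in> V 0" "w \<in> V 1" "v = u + w" by (rule decompose)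
  show ?thesis
  proof (cases i)
    case zero
    with uw that[of u w] show ?thesis by simp
  next
    case one
    with uw that[of w u] show ?thesis by (simp add: add.commute)
  qed
qed

lemma part_sum: "(\<And>k. k \<in> A \<Longrightarrow> f k \<in> V i) \<Longrightarrow> sum f A \<in> V i"
  by (rule subspace_sum[OF subspace_part])

lemma part_scale: "v \<in> V i \<Longrightarrow> c *s v \<in> V i"
  by (rule subspace_scale[OF subspace_part])

lemma part_add: "u \<in> V i \<Longrightarrow> v \<in> V i \<Longrightarrow> u + v \<in> V i"
  by (rule subspace_add[OF subspace_part])

lemma part_diff: "u \<in> V i \<Longrightarrow> v \<in> V i \<Longrightarrow> u - v \<in> V i"
  by (rule subspace_diff[OF subspace_part])

lemma part_zero: "0 \<in> V i"
  by (rule subspace_0[OF subspace_part])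

lemma proj_add: "proj 0 v + proj 1 v = v"
  by (rule decompose[of v]) (simp add: proj_0 proj_1)

lemma component_add:
  assumes "Vector_Spaces.linear scale scale y"
  shows "component 0 y v + component 1 y v = y v"
proof -
  have "component 0 y v + component 1 y v =
      (proj 0 (y (proj 0 v)) + proj 1 (y (proj 0 v))) + (proj 0 (y (proj 1 v)) + proj 1 (y (proj 1 v)))"
    by (simp add: component_def)
  also have "\<dots> = y (proj 0 v + proj 1 v)"
    using assms by (simp add: proj_add[of "y _"] linear_iff_module_hom module_hom.add)
  finally show ?thesis by (simp only: proj_add)
qed

text \<open>With an even left argument no Koszul sign is ever \<open>-1\<close>, so a right argument of mixed parity
  need not be split into its components.\<close>

lemma bracket_even:
  assumes "x \<in> homogeneous_end 0" and "Vector_Spaces.linear scale scale y"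
  shows "bracket x y v = x (y v) - y (x v)"
proof -
  have "component 0 x = x" "component 1 x = 0"
    using component_homogeneous[OF assms(1)] by simp_all
  moreover have "component j y 0 = 0" for j
  proof -
    have "proj k 0 = 0" for k by (rule proj_same[OF part_zero])
    moreover have "y 0 = 0" using assms(2) by (simp add: linear_iff_module_hom module_hom.zero)
    ultimately show ?thesis by (simp add: component_def)
  qed
  ultimately have "bracket x y v = x (component 0 y v + component 1 y v)
      - (component 0 y (x v) + component 1 y (x v))"
    by (simp add: bracket_def homogeneous_end_linear[OF assms(1)])
  then show ?thesis by (simp only: component_add[OF assms(2)])
qed

definition parity_involution :: "'v \<Rightarrow> 'v" where
  "parity_involution v = proj 0 v - proj 1 v"

lemma parity_involution_eq: "u \<in> V 0 \<Longrightarrow> w \<in> V 1 \<Longrightarrow> parity_involution (u + w) = u - w"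
  by (simp add: parity_involution_def proj_0 proj_1)

lemma parity_involution_involutive: "parity_involution (parity_involution v) = v"
proof -
  obtain u w where uw: "u \<in> V 0" "w \<in> V 1" "v = u + w" by (rule decompose)
  have "- w \<in> V 1" using uw subspace_neg subspace_part by blast
  from parity_involution_eq[OF uw(1) this] show ?thesis
    by (simp add: uw parity_involution_eq)
qed

lemma parity_involution_linear: "Vector_Spaces.linear scale scale parity_involution"
proof (rule linearI)
  fix u v c
  obtain u0 u1 where u: "u0 \<in> V 0" "u1 \<in> V 1" "u = u0 + u1" by (rule decompose)
  obtain v0 v1 where v: "v0 \<in> V 0" "v1 \<in> V 1" "v = v0 + v1" by (rule decompose)
  have "u + v = (u0 + v0) + (u1 + v1)" by (simp add: u v)
  then have "parity_involution (u + v) = (u0 + v0) - (u1 + v1)"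
    using u v by (simp only: parity_involution_eq part_add)
  then show "parity_involution (u + v) = parity_involution u + parity_involution v"
    using u v by (simp add: parity_involution_eq)
  have "c *s v = c *s v0 + c *s v1" by (simp add: v scale_right_distrib)
  then have "parity_involution (c *s v) = c *s v0 - c *s v1"
    using v by (simp only: parity_involution_eq part_scale)
  then show "parity_involution (c *s v) = c *s parity_involution v"
    using v by (simp add: parity_involution_eq scale_right_diff_distrib)
qed

lemma involutive_part_image:
  assumes "\<And>v. r (r v) = v" and "\<And>v i. v \<in> V i \<Longrightarrow> r v \<in> V i"
  shows "r ` V i = V i"
proof
  show "r ` V i \<subseteq> V i" using assms(2) by blast
  show "V i \<subseteq> r ` V i" using assms by (metis image_eqI subsetI)
qed

end

section \<open>The orthosymplectic form and its Lie superalgebra\<close>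

context orthosymplectic_space
begin

lemma B_left: "B (u + v) w = B u w + B v w" "B (u - v) w = B u w - B v w"
    "B (c *s v) w = c * B v w" "B 0 w = 0" "B (sum f A) w = (\<Sum>k\<in>A. B (f k) w)"
proof -
  interpret l: module_hom scale "(*)" "\<lambda>v. B v w"
    using linear_left by (simp add: linear_iff_module_hom)
  show "B (u + v) w = B u w + B v w" "B (u - v) w = B u w - B v w"
    "B (c *s v) w = c * B v w" "B 0 w = 0" "B (sum f A) w = (\<Sum>k\<in>A. B (f k) w)"
    by (simp_all add: l.add l.diff l.scale l.sum)
qed

lemma B_right: "B w (u + v) = B w u + B w v" "B w (u - v) = B w u - B w v"
    "B w (c *s v) = c * B w v" "B w 0 = 0" "B w (sum f A) = (\<Sum>k\<in>A. B w (f k))"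
proof -
  interpret l: module_hom scale "(*)" "\<lambda>v. B w v"
    using linear_right by (simp add: linear_iff_module_hom)
  show "B w (u + v) = B w u + B w v" "B w (u - v) = B w u - B w v"
    "B w (c *s v) = c * B w v" "B w 0 = 0" "B w (sum f A) = (\<Sum>k\<in>A. B w (f k))"
    by (simp_all add: l.add l.diff l.scale l.sum)
qed

lemma B_orthogonal: "v \<in> V i \<Longrightarrow> w \<in> V (i + 1) \<Longrightarrow> B v w = 0"
proof (cases i)
  case one
  assume "v \<in> V i" "w \<in> V (i + 1)"
  with one have "v \<in> V 1" "w \<in> V 0" by simp_all
  with supersymmetric[of v 1 w 0] even_form show ?thesis by simp
qed (use even_form in simp)

lemma pairing_partner:
  assumes "v \<in> V i" "v \<noteq> 0"
  obtains u where "u \<in> V i" "B u v \<noteq> 0"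
proof -
  obtain w where w: "B v w \<noteq> 0" using nondegenerate assms by blast
  obtain u u' where u: "u \<in> V i" "u' \<in> V (i + 1)" "w = u + u'" by (rule decompose_parity)
  have "B v u \<noteq> 0" using w u assms(1) by (simp add: B_right B_orthogonal)
  then have "B u v \<noteq> 0" using supersymmetric[OF assms(1) u(1)] by simp
  with u(1) show ?thesis by (rule that)
qed

lemma osp_part_homogeneous: "x \<in> osp_part i \<Longrightarrow> x \<in> homogeneous_end i"
  by (simp add: osp_part_def)

lemma even_skew:
  assumes "x \<in> osp_part 0"
  shows "B (x v) w = - B v (x w)"
proof -
  note x = homogeneous_end_linear[OF osp_part_homogeneous[OF assms]]
  have *: "B (x v) w = - B v (x w)" if "v \<in> V i" "w \<in> V j" for v w i j
    using assms that unfolding osp_part_def by fastforce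
  obtain v0 v1 where v: "v0 \<in> V 0" "v1 \<in> V 1" "v = v0 + v1" by (rule decompose)
  obtain w0 w1 where w: "w0 \<in> V 0" "w1 \<in> V 1" "w = w0 + w1" by (rule decompose)
  show ?thesis
    by (simp add: v w x B_left B_right *[OF v(1) w(1)] *[OF v(1) w(2)] *[OF v(2) w(1)] *[OF v(2) w(2)])
qed

lemma even_skew_power:
  assumes "x \<in> osp_part 0"
  shows "B ((x ^^ k) v) w = (- 1) ^ k * B v ((x ^^ k) w)"
proof (induction k arbitrary: w)
  case (Suc k)
  then show ?case using funpow_swap1[of x k w] by (simp add: even_skew[OF assms])
qed simp

lemma zero_osp_part: "0 \<in> osp_part i"
  by (auto simp: osp_part_def homogeneous_end_def part_zero B_left B_right intro!: linearI)

lemma osp_part_osp: "x \<in> osp_part i \<Longrightarrow> x \<in> osp"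
proof (cases i)
  case zero
  assume "x \<in> osp_part i"
  moreover have "x = x + 0" by simp
  ultimately show ?thesis using zero_osp_part zero unfolding osp_def by blast
next
  case one
  assume "x \<in> osp_part i"
  moreover have "x = 0 + x" by simp
  ultimately show ?thesis using zero_osp_part one unfolding osp_def by blast
qed

lemma centralizerI:
  assumes "e \<in> osp_part 0" and "y \<in> osp_part j" and "\<And>v. y (e v) = e (y v)"
  shows "y \<in> centralizer e"
proof -
  have "bracket e y = 0"
    using bracket_homogeneous[OF osp_part_homogeneous[OF assms(1)] osp_part_homogeneous[OF assms(2)]] assms(3)
    by (simp add: fun_eq_iff)
  with assms(2) show ?thesis by (simp add: centralizer_def osp_part_osp)
qed

lemma even_bracket_zeroD:
  assumes "x \<in> osp_part 0" and "y \<in> osp_part j" and "bracket x y = 0"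
  shows "x (y v) = y (x v)"
  using bracket_homogeneous[OF osp_part_homogeneous[OF assms(1)] osp_part_homogeneous[OF assms(2)], of v] assms(3)
  by simp

lemma involution_stabilizer:
  assumes "Vector_Spaces.linear scale scale r" and inv: "\<And>v. r (r v) = v"
    and "\<And>v i. v \<in> V i \<Longrightarrow> r v \<in> V i" and "\<And>v w. B (r v) (r w) = B v w"
    and "\<And>v. r (e v) = e (r v)"
  shows "r \<in> stabilizer e"
proof -
  have "bij r" using inv by (rule involuntory_imp_bij)
  moreover have "r ` V i = V i" for i by (rule involutive_part_image) (use assms in auto)
  moreover have "Hilbert_Choice.inv r = r" by (rule inv_equality) (simp_all add: inv)
  then have "r \<circ> e \<circ> Hilbert_Choice.inv r = e" using inv assms(5) by (auto simp: fun_eq_iff)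
  ultimately show ?thesis using assms by (simp add: stabilizer_def isometry_group_def)
qed

lemma stabilizer_commute:
  assumes "g \<in> stabilizer e" and "g \<circ> x \<circ> inv g = x"
  shows "g (x v) = x (g v)"
proof -
  have "bij g" using assms by (simp add: stabilizer_def isometry_group_def)
  then have "inv g (g v) = v" by (simp add: bij_is_inj)
  with assms(2) show ?thesis by (metis comp_apply)
qed

lemma parity_involution_stabilizer:
  assumes "e \<in> osp_part 0"
  shows "parity_involution \<in> stabilizer e"
proof (rule involution_stabilizer[OF parity_involution_linear parity_involution_involutive])
  show "parity_involution v \<in> V i" if "v \<in> V i" for v i
  proof (cases i)
    case zero
    then show ?thesis using parity_involution_eq[of v 0] that part_zero by simp
  next
    case one
    then show ?thesis using parity_involution_eq[of 0 v] that part_zero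
      by (simp add: subspace_neg subspace_part)
  qed
  note e = homogeneous_end_linear[OF osp_part_homogeneous[OF assms]]
  show "parity_involution (e v) = e (parity_involution v)" for v
  proof -
    obtain u w where uw: "u \<in> V 0" "w \<in> V 1" "v = u + w" by (rule decompose)
    moreover have "e u \<in> V 0" "e w \<in> V 1"
      using uw homogeneous_end_mem[OF osp_part_homogeneous[OF assms]] by force+
    ultimately show ?thesis by (simp add: e parity_involution_eq)
  qed
  show "B (parity_involution v) (parity_involution w) = B v w" for v w
  proof -
    obtain v0 v1 where v: "v0 \<in> V 0" "v1 \<in> V 1" "v = v0 + v1" by (rule decompose)
    obtain w0 w1 where w: "w0 \<in> V 0" "w1 \<in> V 1" "w = w0 + w1" by (rule decompose)
    have "B v0 w1 = 0" "B v1 w0 = 0"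
      using v w B_orthogonal[of _ 0] B_orthogonal[of _ 1] by simp_all
    with v w show ?thesis by (simp add: parity_involution_eq B_left B_right)
  qed
qed

text \<open>The parity involution commutes with the even component of \<open>x\<close> and anticommutes with the odd
  one, so invariance under it removes the odd component.\<close>

lemma invariant_centre_even:
  assumes "e \<in> osp_part 0" and "x \<in> invariant_centre e"
  shows "x \<in> osp_part 0"
proof -
  let ?d = parity_involution
  obtain y z where yz: "y \<in> osp_part 0" "z \<in> osp_part 1" "x = y + z"
    using assms(2) by (auto simp: invariant_centre_def centre_centralizer_def centralizer_def osp_def)
  note y = homogeneous_end_linear[OF osp_part_homogeneous[OF yz(1)]]
  note z = homogeneous_end_linear[OF osp_part_homogeneous[OF yz(2)]]
  have comm: "?d (x v) = x (?d v)" for v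
    using parity_involution_stabilizer[OF assms(1)] assms(2)
    by (intro stabilizer_commute) (auto simp: invariant_centre_def)
  have z_zero: "z v = 0" if "v \<in> V i" for v i
  proof -
    have yv: "y v \<in> V i" and zv: "z v \<in> V (i + 1)"
      using homogeneous_end_mem[OF osp_part_homogeneous[OF yz(1)] that]
        homogeneous_end_mem[OF osp_part_homogeneous[OF yz(2)] that] by (simp_all only: add.commute add_0)
    have "z v = - z v"
    proof (cases i)
      case zero
      with comm[of v] yv zv that parity_involution_eq[of v 0] parity_involution_eq[of "y v" "z v"]
      show ?thesis by (simp add: yz part_zero)
    next
      case one
      with comm[of v] yv zv that parity_involution_eq[of 0 v] parity_involution_eq[of "z v" "y v"]
        y(4)[of 0 v] z(4)[of 0 v]
      show ?thesis by (simp add: yz part_zero y(3) z(3) add.commute)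
    qed
    then have "2 *s z v = 0"
      by (metis add.right_inverse scale_left_distrib scale_one one_add_one)
    then show ?thesis by simp
  qed
  have "z v = 0" for v
  proof -
    obtain u w where "u \<in> V 0" "w \<in> V 1" "v = u + w" by (rule decompose)
    then show ?thesis by (simp add: z z_zero)
  qed
  then have "x = y" by (simp add: yz fun_eq_iff)
  with yz show ?thesis by simp
qed

lemma osp_part_add:
  assumes "x \<in> osp_part i" and "y \<in> osp_part i"
  shows "x + y \<in> osp_part i"
proof -
  note hom = assms[THEN osp_part_homogeneous]
  have "x + y \<in> homogeneous_end i"
  proof (rule homogeneous_endI)
    show "(x + y) v \<in> V (i + j)" if "v \<in> V j" for v j
      unfolding plus_fun_apply using hom that by (intro part_add homogeneous_end_mem)
  qed (simp_all add: hom[THEN homogeneous_end_linear(1)] hom[THEN homogeneous_end_linear(2)]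
      scale_right_distrib)
  then show ?thesis using assms by (simp add: osp_part_def B_left B_right algebra_simps)
qed

lemma osp_part_scale:
  assumes "x \<in> osp_part i"
  shows "(\<lambda>v. c *s x v) \<in> osp_part i"
proof -
  note hom = assms[THEN osp_part_homogeneous]
  have "(\<lambda>v. c *s x v) \<in> homogeneous_end i"
  proof (rule homogeneous_endI)
    show "c *s x v \<in> V (i + j)" if "v \<in> V j" for v j
      using hom that by (intro part_scale homogeneous_end_mem)
  qed (simp_all add: homogeneous_end_linear[OF hom] scale_right_distrib mult.commute)
  then show ?thesis using assms by (simp add: osp_part_def B_left B_right)
qed

lemma odd_power_osp_part:
  assumes "e \<in> osp_part 0" and "odd k"
  shows "e ^^ k \<in> osp_part 0"
  using assms even_power_homogeneous[OF osp_part_homogeneous[OF assms(1)]]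
  by (simp add: osp_part_def even_skew_power)

text \<open>The converse inclusion of the theorem rests on this criterion: both \<open>\<gg>\<^sup>e\<close> and \<open>G\<^sup>e\<close> consist of
  linear maps commuting with \<open>e\<close>.\<close>

lemma invariant_centreI:
  assumes "e \<in> osp_part 0" and "x \<in> osp_part 0"
    and commute: "\<And>y v. Vector_Spaces.linear scale scale y \<Longrightarrow> (\<And>v. y (e v) = e (y v)) \<Longrightarrow> y (x v) = x (y v)"
  shows "x \<in> invariant_centre e"
proof -
  note hom = assms(1,2)[THEN osp_part_homogeneous]
  have "x \<in> centralizer e"
  proof (rule centralizerI[OF assms(1,2)])
    have "Vector_Spaces.linear scale scale e" using hom(1) by (simp add: homogeneous_end_def)
    then show "x (e v) = e (x v)" for v by (rule commute[symmetric]) simp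
  qed
  moreover have "bracket x y = 0" if y: "y \<in> centralizer e" for y
  proof -
    obtain y0 y1 where "y0 \<in> osp_part 0" "y1 \<in> osp_part 1" "y = y0 + y1"
      using y by (auto simp: centralizer_def osp_def)
    moreover from this have "Vector_Spaces.linear scale scale y0" "Vector_Spaces.linear scale scale y1"
      by (simp_all add: osp_part_def homogeneous_end_def)
    ultimately have lin: "Vector_Spaces.linear scale scale y"
      by (simp add: linear_iff_module_hom module_hom_iff scale_right_distrib)
    have "bracket e y v = 0" for v using y by (simp add: centralizer_def)
    then have "y (e v) = e (y v)" for v by (simp add: bracket_even[OF hom(1) lin])
    with commute[OF lin] show ?thesis by (simp add: bracket_even[OF hom(2) lin] fun_eq_iff)
  qed
  moreover have "g \<circ> x \<circ> inv g = x" if g: "g \<in> stabilizer e" for g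
  proof -
    have ge: "g (e v) = e (g v)" for v
      using g by (intro stabilizer_commute) (auto simp: stabilizer_def)
    have "Vector_Spaces.linear scale scale g" and bij: "bij g"
      using g by (auto simp: stabilizer_def isometry_group_def)
    from commute[OF this(1) ge] show ?thesis
      by (simp add: fun_eq_iff surj_f_inv_f[OF bij_is_surj[OF bij]])
  qed
  ultimately show ?thesis by (simp add: invariant_centre_def centre_centralizer_def)
qed

text \<open>Applying \<open>e\<close> as often as the longest Jordan chain lasts runs every chain down to zero.\<close>

lemma power_annihilates_part:
  assumes "nilpotent_jordan_type e (V i) p" and "e \<in> osp_part 0"
    and "\<And>k. k \<in># p \<Longrightarrow> k \<le> L" and "v \<in> V i"
  shows "(e ^^ L) v = 0"
proof -
  have lin: "Vector_Spaces.linear scale scale (e ^^ L)" for L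
    using even_power_homogeneous[OF osp_part_homogeneous[OF assms(2)]] by (simp add: homogeneous_end_def)
  obtain ks ws where kw: "mset ks = p" "length ws = length ks"
    "\<And>i. i < length ks \<Longrightarrow> (e ^^ (ks ! i)) (ws ! i) = 0"
    "span ((\<lambda>(i, j). (e ^^ j) (ws ! i)) ` {(i, j). i < length ks \<and> j < ks ! i}) = V i"
    using assms(1) unfolding nilpotent_jordan_type_def Let_def by auto
  have zero: "(e ^^ k) 0 = 0" for k
    using lin[of k] by (simp add: linear_iff_module_hom module_hom.zero)
  have "(e ^^ L) ((e ^^ j) (ws ! i)) = 0" if "i < length ks" "j < ks ! i" for i j
  proof -
    have "ks ! i \<le> L" using assms(3) kw(1) that(1) by (metis nth_mem set_mset_mset)
    then have "L + j = L - ks ! i + j + ks ! i" by simp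
    then have "(e ^^ L) ((e ^^ j) (ws ! i)) = (e ^^ (L - ks ! i + j)) ((e ^^ (ks ! i)) (ws ! i))"
      by (metis funpow_add comp_apply)
    then show ?thesis using kw(3)[OF that(1)] zero by simp
  qed
  then have gen: "\<And>u. u \<in> (\<lambda>(i, j). (e ^^ j) (ws ! i)) ` {(i, j). i < length ks \<and> j < ks ! i} \<Longrightarrow> (e ^^ L) u = 0"
    by auto
  interpret l: Vector_Spaces.linear scale scale "e ^^ L" by (rule lin)
  show ?thesis
    using l.eq_0_on_span[OF gen] assms(4) kw(4) by blast
qed

end

section \<open>The largest part\<close>

lemma arrangement_le_largest_part:
  assumes "arrangement p q a b lam" and "k \<in># p + q"
  shows "k \<le> largest_part a b lam"
proof -
  obtain par :: "int \<Rightarrow> bit" where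
    par: "image_mset lam (mset_set {i \<in> {1..int b} \<union> uminus ` {int a + 1..int b}. par i = 0}) = p"
      "image_mset lam (mset_set {i \<in> {1..int b} \<union> uminus ` {int a + 1..int b}. par i = 1}) = q"
    and ab: "a \<le> b"
    and dec: "\<And>i j. 1 \<le> i \<Longrightarrow> i < j \<Longrightarrow> j \<le> int a \<Longrightarrow> lam j < lam i"
    and dec': "\<And>i j. int a < i \<Longrightarrow> i \<le> j \<Longrightarrow> j \<le> int b \<Longrightarrow> lam j \<le> lam i"
    and sym: "\<And>i. int a < i \<Longrightarrow> i \<le> int b \<Longrightarrow> lam (- i) = lam i"
    using assms(1) unfolding arrangement_def Let_def by auto
  have "k \<in># p \<or> k \<in># q" using assms(2) by simp
  then obtain i where i: "i \<in> {1..int b} \<union> uminus ` {int a + 1..int b}" "k = lam i"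
    unfolding par[symmetric] by auto
  from i(1) have "\<exists>i. 1 \<le> i \<and> i \<le> int b \<and> k = lam i"
  proof
    assume "i \<in> uminus ` {int a + 1..int b}"
    then obtain j where "i = - j" "j \<in> {int a + 1..int b}" by (rule imageE)
    with sym[of j] i(2) show ?thesis by (intro exI[of _ j]) simp
  qed (use i(2) in auto)
  then obtain i where "1 \<le> i" "i \<le> int b" "k = lam i" by blast
  then consider "1 \<le> i" "i \<le> int a" "k = lam i" | "int a < i" "i \<le> int b" "k = lam i"
    by linarith
  then show ?thesis
  proof cases
    case 1
    then have "k \<le> lam 1" using dec[of 1 i] by (cases "i = 1") auto
    then show ?thesis using 1 by (auto simp: largest_part_def)
  next
    case 2
    then have "k \<le> lam (int a + 1)" using dec' by auto
    then show ?thesis using 2 by (auto simp: largest_part_def)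
  qed
qed


section \<open>Polynomials in a nilpotent element\<close>

locale nilpotent_orthosymplectic = orthosymplectic_space scale V B
  for scale :: "complex \<Rightarrow> 'v::ab_group_add \<Rightarrow> 'v" (infixr \<open>*s\<close> 75)
    and V :: "bit \<Rightarrow> 'v set" and B +
  fixes e :: "'v \<Rightarrow> 'v" and N :: nat
  assumes e_osp: "e \<in> osp_part 0"
    and N_pos: "N > 0"
    and e_N: "e ^^ N = 0"
    and e_pred_N: "e ^^ (N - 1) \<noteq> 0"
begin

lemma e_power_linear:
  "(e ^^ k) (u + v) = (e ^^ k) u + (e ^^ k) v" "(e ^^ k) (c *s v) = c *s (e ^^ k) v" "(e ^^ k) 0 = 0"
  "(e ^^ k) (u - v) = (e ^^ k) u - (e ^^ k) v" "(e ^^ k) (sum f A) = (\<Sum>a\<in>A. (e ^^ k) (f a))"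
  by (rule homogeneous_end_linear[OF even_power_homogeneous[OF osp_part_homogeneous[OF e_osp]]])+

lemma e_power_mem: "v \<in> V i \<Longrightarrow> (e ^^ k) v \<in> V i"
  using homogeneous_end_mem[OF even_power_homogeneous[OF osp_part_homogeneous[OF e_osp]], of v i k]
  by (simp only: add_0)

lemma e_power_ge: "N \<le> k \<Longrightarrow> (e ^^ k) v = 0"
proof -
  assume "N \<le> k"
  then have "(e ^^ k) v = (e ^^ (k - N)) ((e ^^ N) v)"
    by (metis comp_apply funpow_add le_add_diff_inverse2)
  then show ?thesis by (simp add: e_N e_power_linear)
qed

text \<open>Polynomials in \<open>e\<close> are written as power series truncated at the nilpotency index, because a
  series with nonzero constant term has an inverse series.\<close>

definition act :: "complex fps \<Rightarrow> 'v \<Rightarrow> 'v" where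
  "act f v = (\<Sum>k<N. fps_nth f k *s (e ^^ k) v)"

lemma act_linear: "act f (u + v) = act f u + act f v" "act f (c *s v) = c *s act f v"
    "act f (u - v) = act f u - act f v" "act f 0 = 0"
  by (simp_all add: act_def e_power_linear scale_right_distrib scale_right_diff_distrib
      sum.distrib sum_subtractf scale_sum_right mult.commute)

lemma act_mem: "v \<in> V i \<Longrightarrow> act f v \<in> V i"
  unfolding act_def by (intro part_sum part_scale e_power_mem)

lemma act_one: "act 1 v = v"
  using N_pos by (simp add: act_def if_distrib[of "\<lambda>c. c *s _"] cong: if_cong)

lemma act_mult: "act (f * g) v = act f (act g v)"
proof -
  let ?h = "\<lambda>i j. (fps_nth f i * fps_nth g j) *s (e ^^ (i + j)) v"
  have bound: "i + j < N" if "(e ^^ (i + j)) v \<noteq> 0" for i j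
    using e_power_ge that by (meson not_less)
  have "act f (act g v) = (\<Sum>(i, j)\<in>{..<N} \<times> {..<N}. ?h i j)"
    by (simp add: act_def e_power_linear scale_sum_right sum.cartesian_product funpow_add)
  also have "\<dots> = (\<Sum>(i, j)\<in>{(i, j). i + j < N}. ?h i j)"
    by (rule sum.mono_neutral_right) (auto intro: bound)
  also have "\<dots> = (\<Sum>k<N. \<Sum>i\<le>k. ?h i (k - i))"
    by (rule sum.triangle_reindex)
  also have "\<dots> = act (f * g) v"
    by (simp add: act_def fps_mult_nth scale_sum_left atLeast0AtMost)
  finally show ?thesis by simp
qed

lemma act_commute: "act f (act g v) = act g (act f v)"
  by (metis act_mult mult.commute)

lemma act_cancel: "fps_nth f 0 \<noteq> 0 \<Longrightarrow> act (inverse f) (act f v) = v"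
  by (metis act_mult act_one inverse_mult_eq_1)

lemma commute_act:
  assumes "y \<in> homogeneous_end i" and "\<And>v. y (e v) = e (y v)"
  shows "y (act f v) = act f (y v)"
proof -
  have "y ((e ^^ k) v) = (e ^^ k) (y v)" for k by (induction k) (simp_all add: assms(2))
  then show ?thesis by (simp add: act_def homogeneous_end_linear[OF assms(1)])
qed

section \<open>Rank one elements of the centralizer\<close>

text \<open>The coefficients are arranged so that the leading one is the value \<open>B u (e\<^bsup>N-1\<^esup> z)\<close> of the top pairing: this
  makes the series invertible exactly when the top pairing of \<open>u\<close> and \<open>z\<close> is nonzero.\<close>

definition pairing_series :: "'v \<Rightarrow> 'v \<Rightarrow> complex fps" where
  "pairing_series u z = Abs_fps (\<lambda>k. B u ((e ^^ (N - 1 - k)) z))"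

definition rank_one :: "'v \<Rightarrow> 'v \<Rightarrow> 'v \<Rightarrow> 'v" where
  "rank_one u w z = act (pairing_series u z) w"

lemma rank_one_eq: "rank_one u w z = (\<Sum>k<N. B u ((e ^^ (N - 1 - k)) z) *s (e ^^ k) w)"
  by (simp add: rank_one_def act_def pairing_series_def)

lemma rank_one_linear: "rank_one u w (y + z) = rank_one u w y + rank_one u w z"
    "rank_one u w (c *s z) = c *s rank_one u w z"
  by (simp_all add: rank_one_eq e_power_linear B_right scale_left_distrib sum.distrib scale_sum_right)

lemma rank_one_mem: "w \<in> V j \<Longrightarrow> rank_one u w z \<in> V j"
  by (simp add: rank_one_def act_mem)

lemma rank_one_orthogonal: "u \<in> V i \<Longrightarrow> z \<in> V (i + 1) \<Longrightarrow> rank_one u w z = 0"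
  by (simp add: rank_one_eq B_orthogonal e_power_mem)

text \<open>Replacing \<open>z\<close> by \<open>e z\<close> shifts the summation index by one; the two boundary terms of the shifted
  sums contain \<open>e\<^sup>N\<close> and vanish.\<close>

lemma rank_one_commute: "rank_one u w (e z) = e (rank_one u w z)"
proof -
  note e = homogeneous_end_linear[OF osp_part_homogeneous[OF e_osp]]
  obtain M where N: "N = Suc M" using N_pos gr0_conv_Suc by auto
  have top: "(e ^^ M) (e z) = 0" "e ((e ^^ M) w) = 0"
    using e_N by (simp_all add: N fun_eq_iff funpow_swap1)
  have "rank_one u w (e z) = (\<Sum>k<M. B u ((e ^^ (M - Suc k)) (e z)) *s (e ^^ Suc k) w)"
    unfolding rank_one_eq unfolding N by (subst sum.lessThan_Suc_shift) (simp add: top B_right)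
  also have "\<dots> = (\<Sum>k<M. B u ((e ^^ (M - k)) z) *s (e ^^ Suc k) w)"
  proof (rule sum.cong)
    fix k assume "k \<in> {..<M}"
    then have "M - k = Suc (M - Suc k)" by auto
    then show "B u ((e ^^ (M - Suc k)) (e z)) *s (e ^^ Suc k) w = B u ((e ^^ (M - k)) z) *s (e ^^ Suc k) w"
      by (simp add: funpow_swap1)
  qed simp
  also have "\<dots> = e (rank_one u w z)"
    unfolding rank_one_eq unfolding N by (simp add: e top)
  finally show ?thesis .
qed

lemma rank_one_homogeneous:
  assumes "u \<in> V i" and "w \<in> V j"
  shows "rank_one u w \<in> homogeneous_end (i + j)"
proof -
  have "rank_one u w z \<in> V (i + j + k)" if "z \<in> V k" for z k
  proof (cases "k = i")
    case True
    then have "i + j + k = j" by (cases i; cases j) simp_all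
    then show ?thesis using rank_one_mem[OF assms(2)] by simp
  next
    case False
    then have "k = i + 1" by (cases i; cases k) simp_all
    then show ?thesis using rank_one_orthogonal[OF assms(1)] that part_zero by simp
  qed
  then show ?thesis
    using rank_one_linear by (intro homogeneous_endI)
qed

text \<open>Moving powers of \<open>e\<close> across \<open>B\<close> produces the sign \<open>(-1)\<^sup>k (-1)\<^bsup>N-1-k\<^esup>\<close>, which does not depend on the
  summation index \<open>k\<close>; reversing the order of summation then exchanges \<open>u\<close> and \<open>w\<close>.\<close>

lemma rank_one_adjoint_matching:
  assumes "u \<in> V i" and "w \<in> V j" and "z \<in> V i" and "y \<in> V j"
  shows "B (rank_one u w z) y = koszul i i * (- 1) ^ (N - 1) * B z (rank_one w u y)"
proof -
  have "B (rank_one u w z) y =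
      (\<Sum>k<N. B u ((e ^^ (N - 1 - k)) z) * ((- 1) ^ k * B w ((e ^^ k) y)))"
    by (simp add: rank_one_eq B_left even_skew_power[OF e_osp])
  also have "\<dots> = (\<Sum>k<N. koszul i i * (- 1) ^ (N - 1) * (B w ((e ^^ k) y) * B z ((e ^^ (N - 1 - k)) u)))"
  proof (rule sum.cong)
    fix k assume "k \<in> {..<N}"
    then have sgn: "(- 1) ^ (N - 1) = (- 1) ^ k * ((- 1) ^ (N - 1 - k) :: complex)"
      by (simp flip: power_add)
    have "B u ((e ^^ (N - 1 - k)) z) = koszul i i * B ((e ^^ (N - 1 - k)) z) u"
      using assms e_power_mem supersymmetric by blast
    also have "\<dots> = koszul i i * (- 1) ^ (N - 1 - k) * B z ((e ^^ (N - 1 - k)) u)"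
      by (simp add: even_skew_power[OF e_osp])
    finally have *: "B u ((e ^^ (N - 1 - k)) z) = \<dots>" .
    show "B u ((e ^^ (N - 1 - k)) z) * ((- 1) ^ k * B w ((e ^^ k) y)) =
       koszul i i * (- 1) ^ (N - 1) * (B w ((e ^^ k) y) * B z ((e ^^ (N - 1 - k)) u))"
      unfolding * sgn by (simp only: mult_ac)
  qed simp
  also have "\<dots> = (\<Sum>k<N. koszul i i * (- 1) ^ (N - 1) * (B w ((e ^^ (N - 1 - k)) y) * B z ((e ^^ k) u)))"
    by (rule sum.reindex_bij_witness[of _ "\<lambda>k. N - 1 - k" "\<lambda>k. N - 1 - k"]) auto
  also have "\<dots> = koszul i i * (- 1) ^ (N - 1) * B z (rank_one w u y)"
    by (simp add: rank_one_eq B_right sum_distrib_left)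
  finally show ?thesis .
qed

lemma rank_one_adjoint:
  assumes "u \<in> V i" and "w \<in> V j"
  shows "B (rank_one u w z) y = koszul i i * (- 1) ^ (N - 1) * B z (rank_one w u y)"
proof -
  obtain z0 z1 where z: "z0 \<in> V i" "z1 \<in> V (i + 1)" "z = z0 + z1" by (rule decompose_parity)
  obtain y0 y1 where y: "y0 \<in> V j" "y1 \<in> V (j + 1)" "y = y0 + y1" by (rule decompose_parity)
  have "B z1 (rank_one w u y0) = 0"
    using B_orthogonal[OF z(2), of "rank_one w u y0"] rank_one_mem[OF assms(1)] 
    by (simp only: add.assoc one_add_one bit_2_eq_0 add_0_right)
  moreover have "B (rank_one u w z0) y1 = 0"
    using B_orthogonal[OF rank_one_mem[OF assms(2)] y(2)] .
  ultimately show ?thesis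
    using rank_one_adjoint_matching[OF assms z(1) y(1)]
      rank_one_orthogonal[OF assms(1) z(2)] rank_one_orthogonal[OF assms(2) y(2)]
    by (simp add: z y rank_one_linear B_left B_right)
qed

text \<open>The sign makes the second term the superadjoint of the first one. For equal parities it
  combines the symmetry of \<open>B\<close> with \<open>(-1)\<^bsup>N-1\<^esup>\<close>; for different parities only \<open>(-1)\<^bsup>N-1\<^esup>\<close> remains, the other
  signs being those of the superadjoint itself.\<close>

definition skew_rank_one :: "bit \<Rightarrow> bit \<Rightarrow> 'v \<Rightarrow> 'v \<Rightarrow> 'v \<Rightarrow> 'v" where
  "skew_rank_one i j u w z =
     rank_one u w z - (koszul i j * (- 1) ^ (N - 1)) *s rank_one w u z"

lemma minus_one_power_square: "(- 1) ^ k * ((- 1) ^ k * c) = (c :: complex)"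
  by (metis left_minus_one_mult_self)

lemma skew_rank_one_osp:
  assumes "u \<in> V i" and "w \<in> V j"
  shows "skew_rank_one i j u w \<in> osp_part (i + j)"
proof -
  let ?s = "(- 1) ^ (N - 1) :: complex"
  let ?y = "skew_rank_one i j u w"
  have lin: "?y (a + b) = ?y a + ?y b" "?y (c *s a) = c *s ?y a" for a b c
    by (simp_all add: skew_rank_one_def rank_one_linear scale_right_distrib scale_right_diff_distrib mult.commute)
  have "?y z \<in> V (i + j + k)" if "z \<in> V k" for z k
    unfolding skew_rank_one_def
    using homogeneous_end_mem[OF rank_one_homogeneous[OF assms] that]
      homogeneous_end_mem[OF rank_one_homogeneous[OF assms(2,1)] that]
    by (intro part_diff part_scale) (simp_all only: add.commute[of i j])
  then have hom: "?y \<in> homogeneous_end (i + j)"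
    using lin by (intro homogeneous_endI)
  have "B (?y z) z' = - koszul (i + j) k * B z (?y z')" if z: "z \<in> V k" "z' \<in> V k'" for z z' k k'
  proof -
    have l: "B (?y z) z' = koszul i i * ?s * B z (rank_one w u z')
        - koszul i j * koszul j j * B z (rank_one u w z')"
      by (simp add: skew_rank_one_def B_left rank_one_adjoint[OF assms] rank_one_adjoint[OF assms(2,1)]
          minus_one_power_square mult_ac)
    have r: "B z (?y z') = B z (rank_one u w z') - koszul i j * ?s * B z (rank_one w u z')"
      by (simp add: skew_rank_one_def B_right)
    have o: "k = i \<or> B z (rank_one w u z') = 0" "k = j \<or> B z (rank_one u w z') = 0"
      using B_orthogonal[OF z(1), of "rank_one w u z'"] B_orthogonal[OF z(1), of "rank_one u w z'"]
        rank_one_mem[OF assms(1), of w z'] rank_one_mem[OF assms(2), of u z']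
      by (cases k; cases i; cases j; simp)+
    show ?thesis unfolding l r using o
      by (cases i; cases j; cases k) (auto simp: algebra_simps)
  qed
  with hom show ?thesis by (simp add: osp_part_def)
qed

lemma skew_rank_one_centralizer:
  assumes "u \<in> V i" and "w \<in> V j"
  shows "skew_rank_one i j u w \<in> centralizer e"
proof (rule centralizerI[OF e_osp skew_rank_one_osp[OF assms]])
  show "skew_rank_one i j u w (e v) = e (skew_rank_one i j u w v)" for v
    by (simp add: skew_rank_one_def rank_one_commute
        homogeneous_end_linear[OF osp_part_homogeneous[OF e_osp]])
qed

lemma rank_one_act:
  assumes "u \<in> V i" and "w \<in> V j"
  shows "rank_one u w (act f z) = act f (rank_one u w z)"
  using rank_one_homogeneous[OF assms] rank_one_commute by (rule commute_act)

lemma top_pairing_swap: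
  assumes "u \<in> V i" and "v \<in> V i"
  shows "B u ((e ^^ (N - 1)) v) = koszul i i * (- 1) ^ (N - 1) * B v ((e ^^ (N - 1)) u)"
  using supersymmetric[OF assms(1) e_power_mem[OF assms(2)], of "N - 1"]
  by (simp add: even_skew_power[OF e_osp])

lemma pairing_series_0: "fps_nth (pairing_series u z) 0 = B u ((e ^^ (N - 1)) z)"
  by (simp add: pairing_series_def)

section \<open>Reflections in non-degenerate Jordan blocks\<close>

text \<open>The orthogonal projection onto the \<open>e\<close>-stable space generated by \<open>v\<close>, when \<open>B v (e\<^bsup>N-1\<^esup> v) \<noteq> 0\<close>:
  \<open>rank_one v v\<close> vanishes on the orthogonal complement and acts on the space itself as the
  polynomial \<open>pairing_series v v\<close> in \<open>e\<close>, which is divided out.\<close>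

definition block_projection :: "'v \<Rightarrow> 'v \<Rightarrow> 'v" where
  "block_projection v z = act (inverse (pairing_series v v)) (rank_one v v z)"

context
  fixes i v
  assumes v: "v \<in> V i" and v_top: "B v ((e ^^ (N - 1)) v) \<noteq> 0"
begin

lemma top_sign: "koszul i i * (- 1) ^ (N - 1) = (1 :: complex)"
  using top_pairing_swap[OF v v] v_top by simp

lemma block_projection_linear:
  "block_projection v (y + z) = block_projection v y + block_projection v z"
  "block_projection v (c *s z) = c *s block_projection v z"
  by (simp_all add: block_projection_def rank_one_linear act_linear)

lemma block_projection_generator: "block_projection v v = v"
  using v_top by (simp add: block_projection_def rank_one_def act_cancel pairing_series_0)

lemma block_projection_act: "block_projection v (act f z) = act f (block_projection v z)"
  by (simp add: block_projection_def rank_one_act[OF v v] act_commute)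

lemma block_projection_range: "\<exists>f. block_projection v z = act f v"
  unfolding block_projection_def rank_one_def by (metis act_mult)

lemma block_projection_idem: "block_projection v (block_projection v z) = block_projection v z"
  by (metis block_projection_range block_projection_act block_projection_generator)

lemma block_projection_mem: "z \<in> V j \<Longrightarrow> block_projection v z \<in> V j"
proof (cases "j = i")
  case False
  assume "z \<in> V j"
  moreover from False have "j = i + 1" by (cases i; cases j) simp_all
  ultimately have "block_projection v z = 0"
    by (simp add: block_projection_def rank_one_orthogonal[OF v] act_linear)
  then show ?thesis by (simp add: part_zero)
qed (simp add: block_projection_def act_mem rank_one_mem v)

lemma block_projection_e: "block_projection v (e z) = e (block_projection v z)"
  by (simp add: block_projection_def rank_one_commute
      commute_act[OF osp_part_homogeneous[OF e_osp]])

text \<open>By \<open>top_sign\<close> the number \<open>B v (e\<^bsup>N-1-k\<^esup> v)\<close> is zero for odd \<open>k\<close>, and even powers of \<open>e\<close> are self-adjoint.\<close>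

lemma pairing_series_self_adjoint:
  "B (act (pairing_series v v) y) z = B y (act (pairing_series v v) z)"
proof -
  have "fps_nth (pairing_series v v) k * (- 1) ^ k = fps_nth (pairing_series v v) k" if "k < N" for k
  proof -
    have "B v ((e ^^ (N - 1 - k)) v) = koszul i i * (- 1) ^ (N - 1 - k) * B v ((e ^^ (N - 1 - k)) v)"
      using supersymmetric[OF v e_power_mem[OF v], of "N - 1 - k"]
      by (simp add: even_skew_power[OF e_osp])
    moreover have "(- 1) ^ (N - 1) = (- 1) ^ k * ((- 1) ^ (N - 1 - k) :: complex)"
      using that by (simp flip: power_add)
    ultimately have "(- 1) ^ k * B v ((e ^^ (N - 1 - k)) v) =
        (koszul i i * (- 1) ^ (N - 1)) * B v ((e ^^ (N - 1 - k)) v)" by simp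
    then show ?thesis by (simp add: top_sign[simplified] pairing_series_def mult.commute)
  qed
  then show ?thesis
    by (auto simp: act_def B_left B_right even_skew_power[OF e_osp] simp flip: mult.assoc intro!: sum.cong)
qed

lemma block_projection_self_adjoint: "B (block_projection v y) z = B y (block_projection v z)"
proof -
  let ?Q = "pairing_series v v"
  have Q: "fps_nth ?Q 0 \<noteq> 0" using v_top by (simp add: pairing_series_0)
  \<comment> \<open>The inverse series is avoided on the right by writing the second argument as a value of the
      invertible self-adjoint operator.\<close>
  have "act ?Q (act (inverse ?Q) w) = w" for w
    using act_cancel[OF Q] by (simp add: act_commute)
  then obtain z' where z: "z = act ?Q z'" by metis
  have "B (block_projection v y) z = B (act ?Q (block_projection v y)) z'"
    by (simp add: z pairing_series_self_adjoint)
  also have "\<dots> = B (rank_one v v y) z'"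
    by (simp add: block_projection_def act_commute[of ?Q] act_cancel[OF Q])
  also have "\<dots> = B y (rank_one v v z')"
    by (simp add: rank_one_adjoint[OF v v] top_sign[simplified])
  also have "rank_one v v z' = block_projection v z"
    by (simp add: z block_projection_def rank_one_act[OF v v] act_cancel[OF Q])
  finally show ?thesis .
qed

lemma block_reflection_stabilizer:
  "(\<lambda>z. z - 2 *s block_projection v z) \<in> stabilizer e"
proof (rule involution_stabilizer)
  note lin = block_projection_linear
  have diff: "block_projection v (y - z) = block_projection v y - block_projection v z" for y z
    using lin(1)[of y "- z"] lin(2)[of "- 1" z] by simp
  show "Vector_Spaces.linear scale scale (\<lambda>z. z - 2 *s block_projection v z)"
    by (rule linearI) (simp_all add: lin scale_right_distrib scale_right_diff_distrib mult.commute)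
  show "z - 2 *s block_projection v z - 2 *s block_projection v (z - 2 *s block_projection v z) = z" for z
  proof -
    have "block_projection v (z - 2 *s block_projection v z) = (1 - 2) *s block_projection v z"
      by (simp only: diff lin block_projection_idem scale_left_diff_distrib scale_one)
    then show ?thesis by simp
  qed
  show "z - 2 *s block_projection v z \<in> V j" if "z \<in> V j" for z j
    using that by (intro part_diff part_scale block_projection_mem)
  show "B (y - 2 *s block_projection v y) (z - 2 *s block_projection v z) = B y z" for y z
    by (simp add: B_left B_right block_projection_self_adjoint block_projection_idem)
  show "e z - 2 *s block_projection v (e z) = e (z - 2 *s block_projection v z)" for z
    by (simp add: block_projection_e homogeneous_end_linear[OF osp_part_homogeneous[OF e_osp]])
qed

end

section \<open>Invariant central elements are polynomials\<close>

context
  fixes x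
  assumes x: "x \<in> invariant_centre e"
begin

lemma x_osp: "x \<in> osp_part 0"
  using e_osp x by (rule invariant_centre_even)

lemmas x_linear = homogeneous_end_linear[OF osp_part_homogeneous[OF x_osp]]

lemma x_e: "x (e v) = e (x v)"
proof -
  have "bracket e x = 0"
    using x by (simp add: invariant_centre_def centre_centralizer_def centralizer_def)
  from even_bracket_zeroD[OF e_osp x_osp this, of v] show ?thesis by simp
qed

lemma x_mem: "v \<in> V i \<Longrightarrow> x v \<in> V i"
  using homogeneous_end_mem[OF osp_part_homogeneous[OF x_osp]] by (simp only: add_0)

lemma x_act: "x (act f v) = act f (x v)"
  using osp_part_homogeneous[OF x_osp] x_e by (rule commute_act)

lemma x_skew_rank_one:
  assumes "u \<in> V i" and "w \<in> V j"
  shows "x (skew_rank_one i j u w z) = skew_rank_one i j u w (x z)"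
proof (rule even_bracket_zeroD[OF x_osp skew_rank_one_osp[OF assms]])
  show "bracket x (skew_rank_one i j u w) = 0"
    using x skew_rank_one_centralizer[OF assms]
    by (simp add: invariant_centre_def centre_centralizer_def)
qed

text \<open>Evaluating \<open>x\<close> after the skew rank one map, and the map after \<open>x\<close>, at \<open>c\<close> gives \<open>Q(e) (x w)\<close> and
  \<open>P(e) (Q(e) w)\<close> up to the same factor \<open>s\<close>, where the constant term of \<open>Q\<close> is the top pairing of \<open>u\<close> and
  \<open>c\<close>. The factor is \<open>1\<close> when the adjoint term vanishes and \<open>2\<close> when it doubles the main term.\<close>

lemma polynomial_action_transfer:
  assumes "u \<in> V i" and "w \<in> V j" and "B u ((e ^^ (N - 1)) c) \<noteq> 0"
    and xc: "x c = act P c"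
    and s: "\<And>z. z \<in> {c, x c} \<Longrightarrow> skew_rank_one i j u w z = s *s rank_one u w z" and "s \<noteq> 0"
  shows "x w = act P w"
proof -
  let ?Q = "pairing_series u c"
  have "s *s x (act ?Q w) = x (skew_rank_one i j u w c)"
    by (simp add: s x_linear rank_one_def)
  also have "\<dots> = skew_rank_one i j u w (x c)"
    by (rule x_skew_rank_one[OF assms(1,2)])
  also have "\<dots> = s *s rank_one u w (x c)"
    by (rule s) simp
  also have "rank_one u w (x c) = act P (act ?Q w)"
    by (simp only: xc rank_one_act[OF assms(1,2)]) (simp only: rank_one_def)
  finally have "x (act ?Q w) = act P (act ?Q w)"
    using \<open>s \<noteq> 0\<close> by simp
  then have "act ?Q (x w) = act ?Q (act P w)"
    by (simp add: x_act act_commute)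
  then show ?thesis
    using act_cancel[of ?Q] assms(3) by (metis pairing_series_0)
qed

text \<open>The reflection in the block of \<open>v\<close> forces \<open>x\<close> to preserve that block, where it must act as
  a polynomial in \<open>e\<close>. For \<open>w\<close> orthogonal to the block the map \<open>rank_one w v\<close> vanishes on the block, so transfer
  applies and the same polynomial works on the complement.\<close>

lemma polynomial_symmetric:
  assumes v: "v \<in> V i" and top: "B v ((e ^^ (N - 1)) v) \<noteq> 0"
  shows "\<exists>P. \<forall>w. x w = act P w"
proof -
  let ?p = "block_projection v"
  have comm: "x (?p z) = ?p (x z)" for z
  proof -
    have "(\<lambda>z. z - 2 *s ?p z) (x z) = x ((\<lambda>z. z - 2 *s ?p z) z)"
      using block_reflection_stabilizer[OF v top] x
      by (intro stabilizer_commute) (auto simp: invariant_centre_def)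
    then show ?thesis by (simp add: x_linear)
  qed
  obtain P where P: "x v = act P v"
    using comm[of v] block_projection_range[OF v top, of "x v"] block_projection_generator[OF v top] by metis
  have complement: "x w = act P w" if w: "w \<in> V j" and "?p w = 0" for w j
  proof (rule polynomial_action_transfer[OF v w top P])
    have "B w ((e ^^ k) v) = 0" for k
    proof -
      have "?p ((e ^^ k) v) = (e ^^ k) v"
        by (induction k) (simp_all add: block_projection_generator[OF v top] block_projection_e[OF v top])
      then have "B w ((e ^^ k) v) = B (?p w) ((e ^^ k) v)"
        by (simp add: block_projection_self_adjoint[OF v top])
      then show ?thesis using that by (simp add: B_left)
    qed
    then have "rank_one w v v = 0" by (simp add: rank_one_eq)
    then have "rank_one w v z = 0" if "z \<in> {v, x v}" for z
      using that P by (auto simp: rank_one_act[OF w v] act_linear)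
    then show "skew_rank_one i j v w z = 1 *s rank_one v w z" if "z \<in> {v, x v}" for z
      using that by (simp add: skew_rank_one_def)
  qed simp
  have "x w = act P w" if w: "w \<in> V j" for w j
  proof -
    obtain f where f: "?p w = act f v" using block_projection_range[OF v top] by blast
    have "?p (w - ?p w) = 0"
      using block_projection_linear(1)[OF v top, of "w - ?p w" "?p w"]
      by (simp add: block_projection_idem[OF v top])
    then have "x (w - ?p w) = act P (w - ?p w)"
      using w block_projection_mem[OF v top w] by (intro complement part_diff)
    moreover have "x (?p w) = act P (?p w)"
      by (simp add: f x_act P act_commute)
    ultimately show ?thesis by (simp add: x_linear act_linear)
  qed
  then have "x w = act P w" for w
    by (rule_tac decompose[of w]) (simp add: x_linear act_linear)
  then show ?thesis by blast
qed

text \<open>Here \<open>rank_one v v\<close> is skew-adjoint for every \<open>v\<close> in \<open>V i\<close>, so it commutes with \<open>x\<close>. Evaluation at \<open>v0\<close> of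
  \<open>rank_one u u\<close> finds \<open>P\<close>. Evaluation at \<open>u\<close> of \<open>rank_one v v\<close> then treats all \<open>v\<close> outside the hyperplane
  on which the top pairing with \<open>u\<close> vanishes.\<close>

lemma polynomial_alternating:
  assumes alt: "\<And>v. v \<in> V i \<Longrightarrow> B v ((e ^^ (N - 1)) v) = 0"
    and u: "u \<in> V i" and v0: "v0 \<in> V i" and top: "B u ((e ^^ (N - 1)) v0) \<noteq> 0"
  shows "\<exists>P. \<forall>w. x w = act P w"
proof -
  have "B (u + v0) ((e ^^ (N - 1)) (u + v0)) = 0"
    using u v0 by (intro alt part_add)
  then have swap: "B v0 ((e ^^ (N - 1)) u) = - B u ((e ^^ (N - 1)) v0)"
    using alt[OF u] alt[OF v0] by (simp add: B_left B_right e_power_linear add_eq_0_iff)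
  then have "- B u ((e ^^ (N - 1)) v0) = koszul i i * (- 1) ^ (N - 1) * B u ((e ^^ (N - 1)) v0)"
    using top_pairing_swap[OF u v0] by (metis minus_minus mult_minus_right)
  then have sign: "koszul i i * (- 1) ^ (N - 1) = (- 1 :: complex)"
    using top by (metis mult_cancel_right mult_minus1)
  have double: "skew_rank_one i i v v z = 2 *s rank_one v v z" for v z
    by (simp add: skew_rank_one_def sign[simplified])
      (metis scale_left_distrib scale_one one_add_one)
  obtain P where P: "x u = act P u"
  proof
    let ?Q = "pairing_series u v0"
    have "2 *s x (act ?Q u) = 2 *s act (pairing_series u (x v0)) u"
      using x_skew_rank_one[OF u u, of v0] by (simp add: double x_linear rank_one_def)
    then have "act ?Q (x u) = act (pairing_series u (x v0)) u"
      by (simp add: x_act)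
    then show "x u = act (inverse ?Q * pairing_series u (x v0)) u"
      using act_cancel[of ?Q "x u"] top by (simp add: pairing_series_0 act_mult)
  qed
  have generic: "x v = act P v" if v: "v \<in> V i" and "B u ((e ^^ (N - 1)) v) \<noteq> 0" for v
  proof (rule polynomial_action_transfer[OF v v _ P, where s = 2])
    show "B v ((e ^^ (N - 1)) u) \<noteq> 0"
      using that top_pairing_swap[OF u v] by (simp add: sign[simplified])
  qed (simp_all add: double)
  have same: "x w = act P w" if w: "w \<in> V i" for w
  proof (cases "B u ((e ^^ (N - 1)) w) = 0")
    case True
    \<comment> \<open>The shift by \<open>v0\<close> moves \<open>w\<close> off the hyperplane.\<close>
    then have "x (w + v0) = act P (w + v0)"
      using w v0 top by (intro generic part_add) (simp_all add: e_power_linear B_right)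
    with generic[OF v0 top] show ?thesis by (simp add: x_linear act_linear)
  qed (use generic w in blast)
  have other: "x w = act P w" if w: "w \<in> V (i + 1)" for w
  proof (rule polynomial_action_transfer[OF v0 w _ P])
    show "B v0 ((e ^^ (N - 1)) u) \<noteq> 0" using swap top by simp
    have "rank_one w v0 z = 0" if "z \<in> V i" for z
      using rank_one_orthogonal[OF w, of z v0] that by (cases i) simp_all
    then show "skew_rank_one i (i + 1) v0 w z = 1 *s rank_one v0 w z" if "z \<in> {u, x u}" for z
      using that u x_mem[OF u] by (auto simp: skew_rank_one_def)
  qed simp
  have "x w = act P w" for w
    by (rule decompose_parity[of i w]) (simp add: x_linear act_linear same other)
  then show ?thesis by blast
qed

lemma invariant_centre_polynomial: "\<exists>P. \<forall>w. x w = act P w"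
proof -
  have "\<exists>i v. v \<in> V i \<and> (e ^^ (N - 1)) v \<noteq> 0"
  proof (rule ccontr)
    assume "\<not> ?thesis"
    then have "(e ^^ (N - 1)) v = 0" for v
      by (rule_tac decompose[of v]) (auto simp: e_power_linear)
    then show False using e_pred_N by (auto simp: fun_eq_iff)
  qed
  then obtain i v where v: "v \<in> V i" "(e ^^ (N - 1)) v \<noteq> 0" by blast
  obtain u where u: "u \<in> V i" "B u ((e ^^ (N - 1)) v) \<noteq> 0"
    using pairing_partner[OF e_power_mem[OF v(1)] v(2)] by blast
  show ?thesis
    using polynomial_symmetric polynomial_alternating[OF _ u(1) v(1) u(2)] by blast
qed

text \<open>Taking adjoints changes the sign of the odd coefficients only, so averaging \<open>x\<close> with the negative
  of its adjoint, which is \<open>x\<close> again, removes the even coefficients.\<close>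

lemma invariant_centre_odd_polynomial:
  "\<exists>c. \<forall>v. x v = (\<Sum>k | k < N \<and> odd k. c k *s (e ^^ k) v)"
proof -
  obtain P where P: "\<And>w. x w = act P w" using invariant_centre_polynomial by blast
  define c where "c = fps_nth P"
  have x1: "x v = (\<Sum>k<N. c k *s (e ^^ k) v)" for v
    by (simp add: P act_def c_def)
  define d where "d k = - ((- 1) ^ k * c k)" for k
  have x2: "x v = (\<Sum>k<N. d k *s (e ^^ k) v)" (is "_ = ?r") for v
  proof -
    have "B (x v - ?r) w = 0" for w
    proof -
      have "B (x v) w = - B v (x w)" by (simp add: even_skew[OF x_osp])
      also have "\<dots> = (\<Sum>k<N. d k * ((- 1) ^ k * B v ((e ^^ k) w)))"
        by (simp add: x1 d_def B_right sum_negf mult_ac minus_one_power_square)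
      also have "\<dots> = B ?r w" by (simp add: B_left even_skew_power[OF e_osp])
      finally show ?thesis by (simp add: B_left)
    qed
    then have "x v - ?r = 0" by (rule nondegenerate)
    then show ?thesis by simp
  qed
  have "x v = (\<Sum>k | k < N \<and> odd k. c k *s (e ^^ k) v)" for v
  proof -
    have "2 *s x v = x v + x v"
      by (metis scale_left_distrib scale_one one_add_one)
    also have "\<dots> = (\<Sum>k<N. (c k + d k) *s (e ^^ k) v)"
      by (subst (1) x1, subst x2) (simp add: scale_left_distrib sum.distrib)
    also have "\<dots> = (\<Sum>k | k < N \<and> odd k. (c k + d k) *s (e ^^ k) v)"
      by (rule sum.mono_neutral_right) (auto simp: d_def)
    also have "\<dots> = (\<Sum>k | k < N \<and> odd k. 2 *s c k *s (e ^^ k) v)"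
      by (rule sum.cong) (auto simp: d_def)
    also have "\<dots> = 2 *s (\<Sum>k | k < N \<and> odd k. c k *s (e ^^ k) v)"
      by (simp only: scale_sum_right)
    finally show ?thesis by (simp only: scale_cancel_left) simp
  qed
  then show ?thesis by blast
qed

end

end

section \<open>The invariant centre\<close>

lemma sum_fun_apply: "(\<Sum>k\<in>A. f k) v = (\<Sum>k\<in>A. f k v)"
  by (induction A rule: infinite_finite_induct) simp_all

theorem theorem24:
  fixes scale :: "complex \<Rightarrow> 'v::ab_group_add \<Rightarrow> 'v"
    and V :: "bit \<Rightarrow> 'v set"
    and B :: "'v \<Rightarrow> 'v \<Rightarrow> complex"
    and m n a b :: nat
    and e :: "'v \<Rightarrow> 'v"
    and p q :: "nat multiset"
    and lam :: "int \<Rightarrow> nat"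
  assumes "orthosymplectic_space scale V B"
    and "m \<ge> 1" and "n \<ge> 1"
    and "vector_space.dim scale (V 0) = m" and "vector_space.dim scale (V 1) = 2 * n"
    and "e \<in> orthosymplectic_space.osp_part scale V B 0"
    and "\<exists>k. e ^^ k = 0"
    and "superspace.nilpotent_jordan_type scale e (V 0) p"
    and "superspace.nilpotent_jordan_type scale e (V 1) q"
    and "arrangement p q a b lam"
  shows "orthosymplectic_space.invariant_centre scale V B e =
    module.span (\<lambda>c f v. scale c (f v)) {e ^^ l | l. odd l \<and> l \<le> largest_part a b lam - 1}"
proof -
  interpret orthosymplectic_space scale V B by (rule assms(1))
  note e = assms(6)
  let ?L = "largest_part a b lam"
  let ?C = "{x \<in> osp_part 0. \<forall>y. Vector_Spaces.linear scale scale y \<longrightarrow>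
    (\<forall>v. y (e v) = e (y v)) \<longrightarrow> (\<forall>v. y (x v) = x (y v))}"
  interpret F: module "\<lambda>c f v. scale c (f v)"
    by unfold_locales (simp_all add: fun_eq_iff scale_right_distrib scale_left_distrib)
  have e_L: "e ^^ ?L = 0"
  proof
    fix v
    obtain u w where uw: "u \<in> V 0" "w \<in> V 1" "v = u + w" by (rule decompose)
    have "(e ^^ ?L) u = 0"
      using arrangement_le_largest_part[OF assms(10)]
      by (intro power_annihilates_part[OF assms(8) e _ uw(1)]) simp
    moreover have "(e ^^ ?L) w = 0"
      using arrangement_le_largest_part[OF assms(10)]
      by (intro power_annihilates_part[OF assms(9) e _ uw(2)]) simp
    moreover have "(e ^^ k) (u + w) = (e ^^ k) u + (e ^^ k) w" for k
      by (rule homogeneous_end_linear(1)[OF even_power_homogeneous[OF osp_part_homogeneous[OF e]]])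
    ultimately show "(e ^^ ?L) v = 0 v" by (simp add: uw)
  qed
  show ?thesis
  proof
    show "invariant_centre e \<subseteq> F.span {e ^^ l | l. odd l \<and> l \<le> ?L - 1}"
    proof
      fix x assume x: "x \<in> invariant_centre e"
      define N where "N = (LEAST k. e ^^ k = 0)"
      have N: "e ^^ N = 0" "N \<le> ?L"
        unfolding N_def using e_L by (rule LeastI, intro Least_le)
      show "x \<in> F.span {e ^^ l | l. odd l \<and> l \<le> ?L - 1}"
      proof (cases "N = 0")
        case True
        \<comment> \<open>The identity is zero, that is, the space is trivial.\<close>
        then have "v = 0" for v :: 'v using N by (simp add: fun_eq_iff)
        then have "x = 0" by (simp add: fun_eq_iff)
        then show ?thesis by (simp add: F.span_zero)
      next
        case False
        then interpret nilpotent_orthosymplectic scale V B e N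
          using N e not_less_Least[of "N - 1" "\<lambda>k. e ^^ k = 0"] by unfold_locales (auto simp: N_def)
        obtain c where "\<And>v. x v = (\<Sum>k | k < N \<and> odd k. scale (c k) ((e ^^ k) v))"
          using invariant_centre_odd_polynomial[OF x] by blast
        then have "x = (\<Sum>k | k < N \<and> odd k. (\<lambda>v. scale (c k) ((e ^^ k) v)))"
          by (simp add: fun_eq_iff sum_fun_apply)
        also have "\<dots> \<in> F.span {e ^^ l | l. odd l \<and> l \<le> ?L - 1}"
        proof (intro F.span_sum F.span_scale F.span_base)
          fix k assume "k \<in> {k. k < N \<and> odd k}"
          then have "odd k \<and> k \<le> ?L - 1" using N(2) by auto
          then show "e ^^ k \<in> {e ^^ l | l. odd l \<and> l \<le> ?L - 1}" by blast
        qed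
        finally show ?thesis .
      qed
    qed
    have "F.span {e ^^ l | l. odd l \<and> l \<le> ?L - 1} \<subseteq> ?C"
    proof (rule F.span_minimal)
      have "y ((e ^^ k) v) = (e ^^ k) (y v)" if "\<And>v. y (e v) = e (y v)" for y k v
        by (induction k) (simp_all add: that)
      then show "{e ^^ l | l. odd l \<and> l \<le> ?L - 1} \<subseteq> ?C"
        using odd_power_osp_part[OF e] by blast
      show "F.subspace ?C"
        by (rule F.subspaceI)
          (auto simp: zero_osp_part osp_part_add osp_part_scale linear_iff_module_hom
            module_hom.add module_hom.scale module_hom.zero)
    qed
    also have "?C \<subseteq> invariant_centre e"
      using invariant_centreI[OF e] by blast
    finally show "F.span {e ^^ l | l. odd l \<and> l \<le> ?L - 1} \<subseteq> invariant_centre e" .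
  qed
qed

end
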